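(* Let $G$ be a graph and let $k\in\mathbb{N}$. Suppose that the complement $G^c$ is $k$-regular and has girth at least five. Then: (i) if $k$ is even, or if $k$ is odd and $G^c$ contains a perfect matching, then $\mathrm{lbox}(G)=\left\lfloor\tfrac{k}{2}+1\right\rfloor$; (ii) if $k$ is odd and $G^c$ does not contain a perfect matching, then $\mathrm{lbox}(G)=\tfrac{k+3}{2}$.
   Context: All graphs are finite and simple. The girth of a graph is the length of a shortest cycle (infinite if acyclic). A real interval is either a bounded interval of $\mathbb{R}$ or $\mathbb{R}$ itself. For an integer $d'\ge 1$, a $d'$-box is a Cartesian product $I_1\times\cdots\times I_{d'}$ of real intervals; it is local in dimension $i$ if $I_i$ is bounded. A $d$-local box in dimension $d'\ge d$ is a $d'$-box that is local in at most $d$ dimensions. The local boxicity $\mathrm{lbox}(G)$ of a graph $G$ is the minimum integer $d$ such that, for some $d'$, there are $d$-local boxes $(B_v)_{v\in V(G)}$ in dimension $d'$ such that two distinct vertices $u,v$ are adjacent in $G$ if and only if $B_u\cap B_v\neq\emptyset$. *)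

theory Defs
  imports "HOL-Analysis.Analysis" "HOL-Library.FuncSet" "HOL-Library.Extended_Nat"
begin

text \<open>A finite simple graph is given by its vertex set \<open>V\<close> and its edge set \<open>E\<close>, edges being
  two-element subsets of \<open>V\<close>.\<close>

definition simple_graph :: "'a set \<Rightarrow> 'a set set \<Rightarrow> bool" where
  "simple_graph V E \<longleftrightarrow> finite V \<and> (\<forall>e\<in>E. e \<subseteq> V \<and> card e = 2)"

definition complement_edges :: "'a set \<Rightarrow> 'a set set \<Rightarrow> 'a set set" where
  "complement_edges V E = {e. e \<subseteq> V \<and> card e = 2 \<and> e \<notin> E}"

definition regular_graph :: "nat \<Rightarrow> 'a set \<Rightarrow> 'a set set \<Rightarrow> bool" where
  "regular_graph k V E \<longleftrightarrow> (\<forall>v\<in>V. card {e \<in> E. v \<in> e} = k)"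

definition is_cycle :: "'a set set \<Rightarrow> 'a list \<Rightarrow> bool" where
  "is_cycle E c \<longleftrightarrow> 3 \<le> length c \<and> distinct c \<and>
     (\<forall>i < length c. {c ! i, c ! (Suc i mod length c)} \<in> E)"

text \<open>The infimum of the empty set in \<^typ>\<open>enat\<close> is \<open>\<infinity>\<close>, the girth of an acyclic graph.\<close>

definition girth :: "'a set set \<Rightarrow> enat" where
  "girth E = (INF c \<in> {c. is_cycle E c}. enat (length c))"

definition perfect_matching :: "'a set \<Rightarrow> 'a set set \<Rightarrow> 'a set set \<Rightarrow> bool" where
  "perfect_matching V E M \<longleftrightarrow> M \<subseteq> E \<and> (\<forall>v\<in>V. \<exists>!e. e \<in> M \<and> v \<in> e)"

text \<open>Bounded intervals may be open, closed or half-open, and may be single points; as usual for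
  intersection representations they are nonempty, which also makes the factors of a box unique.\<close>

definition real_interval :: "real set \<Rightarrow> bool" where
  "real_interval S \<longleftrightarrow> (S \<noteq> {} \<and> is_interval S \<and> bounded S) \<or> S = UNIV"

text \<open>A box in dimension \<open>d'\<close> is a set of functions on the index set \<open>{1..d'}\<close>, namely the product of
  the intervals \<open>I 1, \<dots>, I d'\<close>.\<close>

definition local_box :: "nat \<Rightarrow> nat \<Rightarrow> (nat \<Rightarrow> real) set \<Rightarrow> bool" where
  "local_box d d' B \<longleftrightarrow>
     (\<exists>I. (\<forall>i\<in>{1..d'}. real_interval (I i)) \<and> B = (\<Pi>\<^sub>E i\<in>{1..d'}. I i) \<and>
          card {i \<in> {1..d'}. bounded (I i)} \<le> d)"

definition local_box_representation ::
    "'a set \<Rightarrow> 'a set set \<Rightarrow> nat \<Rightarrow> nat \<Rightarrow> ('a \<Rightarrow> (nat \<Rightarrow> real) set) \<Rightarrow> bool" where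
  "local_box_representation V E d d' B \<longleftrightarrow>
     1 \<le> d' \<and> d \<le> d' \<and> (\<forall>v\<in>V. local_box d d' (B v)) \<and>
     (\<forall>u\<in>V. \<forall>v\<in>V. u \<noteq> v \<longrightarrow> ({u, v} \<in> E \<longleftrightarrow> B u \<inter> B v \<noteq> {}))"

definition lbox :: "'a set \<Rightarrow> 'a set set \<Rightarrow> nat" where
  "lbox V E = (LEAST d. \<exists>d' B. local_box_representation V E d d' B)"

end

theory Submission
  imports Defs
begin

text \<open>A dimension of a box representation of \<open>G\<close> contributes to the complement \<open>H\<close> of \<open>G\<close> the graph of
  disjoint pairs of intervals. This is the comparability graph of an interval order and
  has no induced \<open>2K\<^sub>2\<close>; as \<open>H\<close> has girth at least five, one of its edges meets all others, so it is
  a double star. Hence representations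
  of \<open>G\<close> are covers of \<open>H\<close> by double stars, and \<open>d\<close> bounds the number of double stars at a vertex.
  A double star with \<open>e\<close> edges has \<open>e + 1\<close> vertices, so double counting gives \<open>k < 2d\<close>; if
  \<open>2d = k + 1\<close>, there are at most \<open>|V| / 2\<close> double stars and for \<open>k > 1\<close> every vertex has to be a centre,
  so the central edges form a perfect matching. Conversely, the stars formed by the out-edges in a
  balanced orientation of \<open>H\<close>, merged in pairs along a perfect matching if there is one, attain the
  bound.\<close>

section \<open>Short cycles and degree sums\<close>

lemma girth_ge_5_no_triangle:
  assumes "5 \<le> girth H" "{a, b} \<in> H" "{b, c} \<in> H" "{c, a} \<in> H" "a \<noteq> b" "b \<noteq> c" "a \<noteq> c"
  shows False
proof -
  have "is_cycle H [a, b, c]"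
    using assms by (simp add: is_cycle_def All_less_Suc)
  then have "girth H \<le> enat (length [a, b, c])"
    unfolding girth_def by (intro INF_lower) simp
  with assms(1) have "5 \<le> enat (length [a, b, c])" by (rule order_trans)
  then show False by (simp add: numeral_eq_enat)
qed

lemma girth_ge_5_no_4_cycle:
  assumes "5 \<le> girth H" "{a, b} \<in> H" "{b, c} \<in> H" "{c, d} \<in> H" "{d, a} \<in> H"
    "distinct [a, b, c, d]"
  shows False
proof -
  have "is_cycle H [a, b, c, d]"
    using assms by (simp add: is_cycle_def All_less_Suc)
  then have "girth H \<le> enat (length [a, b, c, d])"
    unfolding girth_def by (intro INF_lower) simp
  with assms(1) have "5 \<le> enat (length [a, b, c, d])" by (rule order_trans)
  then show False by (simp add: numeral_eq_enat)
qed

lemma sum_degrees: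
  assumes "finite V" "finite M" "\<And>e. e \<in> M \<Longrightarrow> e \<subseteq> V"
  shows "(\<Sum>v\<in>V. card {e \<in> M. v \<in> e}) = (\<Sum>e\<in>M. card e)"
proof -
  have "(\<Sum>v\<in>V. \<Sum>e | e \<in> M \<and> v \<in> e. 1::nat) = (\<Sum>e\<in>M. \<Sum>v | v \<in> V \<and> v \<in> e. 1)"
    using assms(1,2) by (rule sum.swap_restrict)
  also have "\<dots> = (\<Sum>e\<in>M. card e)"
  proof (rule sum.cong[OF refl])
    fix e assume "e \<in> M"
    then have "{v. v \<in> V \<and> v \<in> e} = e" using assms(3) by blast
    then show "(\<Sum>v | v \<in> V \<and> v \<in> e. 1) = card e" by simp
  qed
  finally show ?thesis by simp
qed

section \<open>Balanced orientations\<close>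

text \<open>An edge oriented from \<open>b\<close> to \<open>a\<close> is encoded by the vector \<open>\<delta>\<^sub>a - \<delta>\<^sub>b\<close>. Two edges with a common
  endpoint are merged into one by a signed sum that cancels there, which drives the induction.\<close>

lemma balanced_signs:
  fixes x :: "'e \<Rightarrow> 'v \<Rightarrow> int"
  assumes "finite F" "\<And>e. e \<in> F \<Longrightarrow> \<exists>a b. x e = (\<lambda>v. of_bool (v = a) - of_bool (v = b))"
  shows "\<exists>s. (\<forall>e. s e = 1 \<or> s e = -1) \<and> (\<forall>v. \<bar>\<Sum>e\<in>F. s e * x e v\<bar> \<le> 1)"
  using assms
proof (induction "card F" arbitrary: F x rule: less_induct)
  case less
  show ?case
  proof (cases "\<exists>e1\<in>F. \<exists>e2\<in>F. \<exists>w. e1 \<noteq> e2 \<and> x e1 w \<noteq> 0 \<and> x e2 w \<noteq> 0")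
    case True
    then obtain e1 e2 w where e: "e1 \<in> F" "e2 \<in> F" "e1 \<noteq> e2" "x e1 w \<noteq> 0" "x e2 w \<noteq> 0"
      by blast
    \<comment> \<open>A vector that is nonzero at \<open>w\<close> is, up to the sign
      \<open>p\<close>, an edge oriented from its other endpoint \<open>a\<close> to
      \<open>w\<close>.\<close>
    have *: "\<exists>p a. (p = 1 \<or> p = -1) \<and> x e = (\<lambda>v. p * (of_bool (v = w) - of_bool (v = a)))"
      if eF: "e \<in> F" and nz: "x e w \<noteq> 0" for e
    proof -
      obtain a b where ab: "x e = (\<lambda>v. of_bool (v = a) - of_bool (v = b))"
        using less.prems(2)[OF eF] by blast
      have "w = a \<or> w = b" using nz ab by (cases "w = a") auto
      then consider "w = a" | "w = b" by blast
      then show ?thesis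
      proof cases
        case 1
        with ab show ?thesis by (intro exI[of _ 1] exI[of _ b]) simp
      next
        case 2
        with ab show ?thesis by (intro exI[of _ "-1"] exI[of _ a]) auto
      qed
    qed
    obtain p1 a1 where 1: "p1 = 1 \<or> p1 = -1" "x e1 = (\<lambda>v. p1 * (of_bool (v = w) - of_bool (v = a1)))"
      using *[OF e(1,4)] by blast
    obtain p2 a2 where 2: "p2 = 1 \<or> p2 = -1" "x e2 = (\<lambda>v. p2 * (of_bool (v = w) - of_bool (v = a2)))"
      using *[OF e(2,5)] by blast
    \<comment> \<open>Index \<open>e1\<close> now carries (delta_w - delta_a1) - (delta_w -
      delta_a2), in which \<open>w\<close> has cancelled. If \<open>a1 = a2\<close>, this is the
      zero vector, which the hypothesis on \<open>x\<close> permits as the case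
      \<open>a = b\<close>.\<close>
    define y where "y = x(e1 := (\<lambda>v. of_bool (v = a2) - of_bool (v = a1)))"
    have y1: "y e1 v = p1 * x e1 v - p2 * x e2 v" for v
      using 1 2 by (auto simp: y_def)
    have "card (F - {e2}) < card F"
      using less.prems(1) e(2) by (rule card_Diff1_less)
    moreover have "\<exists>a b. y e = (\<lambda>v. of_bool (v = a) - of_bool (v = b))" if "e \<in> F - {e2}" for e
      using less.prems(2)[of e] that by (cases "e = e1") (auto simp: y_def)
    ultimately obtain s where s: "\<And>e. s e = 1 \<or> s e = -1"
        "\<And>v. \<bar>\<Sum>e\<in>F - {e2}. s e * y e v\<bar> \<le> 1"
      using less.hyps[of "F - {e2}" y] less.prems(1) by blast
    \<comment> \<open>The sign of the merged vector passes to \<open>e1\<close> and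
      \<open>e2\<close> with the coefficients \<open>p1\<close> and \<open>- p2\<close> from
      \<open>y1\<close>, so the signed sum at every vertex is unchanged.\<close>
    define t where "t = s(e1 := p1 * s e1, e2 := - p2 * s e1)"
    have "(\<Sum>e\<in>F. t e * x e v) = (\<Sum>e\<in>F - {e2}. s e * y e v)" for v
    proof -
      have fin: "finite (F - {e2})" "e1 \<in> F - {e2}" using less.prems(1) e by auto
      have "(\<Sum>e\<in>F. t e * x e v) = t e2 * x e2 v + (t e1 * x e1 v + (\<Sum>e\<in>F - {e2} - {e1}. t e * x e v))"
        using less.prems(1) e(2) fin by (simp add: sum.remove)
      also have "(\<Sum>e\<in>F - {e2} - {e1}. t e * x e v) = (\<Sum>e\<in>F - {e2} - {e1}. s e * y e v)"
        by (rule sum.cong) (auto simp: t_def y_def)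
      also have "t e2 * x e2 v + (t e1 * x e1 v + (\<Sum>e\<in>F - {e2} - {e1}. s e * y e v))
          = s e1 * y e1 v + (\<Sum>e\<in>F - {e2} - {e1}. s e * y e v)"
        using e(3) by (simp add: t_def y1 algebra_simps)
      also have "\<dots> = (\<Sum>e\<in>F - {e2}. s e * y e v)"
        using fin by (simp add: sum.remove)
      finally show ?thesis .
    qed
    moreover have "t e = 1 \<or> t e = -1" for e
      unfolding t_def using s(1)[of e] s(1)[of e1] 1(1) 2(1) by (elim disjE) simp_all
    ultimately show ?thesis using s(2) by (intro exI[of _ t]) simp
  next
    case False
    \<comment> \<open>No two supports meet, so each sum has at most one nonzero term, and that term
      is 1 or -1.\<close>
    have "\<bar>\<Sum>e\<in>F. 1 * x e v\<bar> \<le> 1" for v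
    proof (cases "\<exists>e\<in>F. x e v \<noteq> 0")
      case True
      then obtain e where e: "e \<in> F" "x e v \<noteq> 0" by blast
      have "(\<Sum>e'\<in>F. 1 * x e' v) = x e v + (\<Sum>e'\<in>F - {e}. x e' v)"
        using less.prems(1) e(1) by (simp add: sum.remove)
      also have "(\<Sum>e'\<in>F - {e}. x e' v) = 0"
        using False e by (intro sum.neutral) blast
      finally show ?thesis using less.prems(2)[OF e(1)] by (auto split: if_splits)
    qed (simp add: sum.neutral)
    then show ?thesis by (intro exI[of _ "\<lambda>_. 1"]) simp
  qed
qed

text \<open>Here \<open>h e\<close> is the head of \<open>e\<close>. The signed sum of the edge
  vectors at \<open>v\<close> is in-degree minus out-degree, i.e. twice the in-degree minus the
  degree, so an upper bound of 1 on it is the claim.\<close>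

lemma balanced_orientation:
  assumes "finite F" "\<And>e. e \<in> F \<Longrightarrow> card e = 2"
  shows "\<exists>h. (\<forall>e\<in>F. h e \<in> e) \<and> (\<forall>v. 2 * card {e \<in> F. h e = v} \<le> card {e \<in> F. v \<in> e} + 1)"
proof -
  have "\<forall>e\<in>F. \<exists>a b. e = {a, b} \<and> a \<noteq> b" using assms(2) by (simp add: card_2_iff)
  then obtain a b where ab: "\<And>e. e \<in> F \<Longrightarrow> e = {a e, b e} \<and> a e \<noteq> b e" by metis
  define x where "x e v = (of_bool (v = a e) - of_bool (v = b e) :: int)" for e v
  have "\<exists>s. (\<forall>e. s e = 1 \<or> s e = -1) \<and> (\<forall>v. \<bar>\<Sum>e\<in>F. s e * x e v\<bar> \<le> 1)"
    by (rule balanced_signs[OF assms(1)]) (auto simp only: x_def)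
  then obtain s where s: "\<And>e. s e = 1 \<or> s e = -1" "\<And>v. \<bar>\<Sum>e\<in>F. s e * x e v\<bar> \<le> 1" by blast
  define h where "h e = (if s e = 1 then a e else b e)" for e
  have "2 * card {e \<in> F. h e = v} \<le> card {e \<in> F. v \<in> e} + 1" for v
  proof -
    have "s e * x e v = 2 * of_bool (h e = v) - of_bool (v \<in> e)" if "e \<in> F" for e
    proof -
      have "v \<in> e \<longleftrightarrow> v = a e \<or> v = b e" "a e \<noteq> b e" using ab[OF that] by auto
      then show ?thesis using s(1)[of e] by (auto simp: x_def h_def)
    qed
    then have "(\<Sum>e\<in>F. s e * x e v) = (\<Sum>e\<in>F. 2 * of_bool (h e = v) - of_bool (v \<in> e))"
      by (rule sum.cong[OF refl])
    also have "\<dots> = 2 * int (card {e \<in> F. h e = v}) - int (card {e \<in> F. v \<in> e})"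
      using assms(1)
      by (simp add: sum_subtractf sum_distrib_left[symmetric] Int_def)
    finally show ?thesis using s(2)[of v] by linarith
  qed
  moreover have "h e \<in> e" if "e \<in> F" for e
  proof -
    have "a e \<in> e" "b e \<in> e" using ab[OF that] by auto
    then show ?thesis by (simp add: h_def)
  qed
  ultimately show ?thesis by blast
qed

section \<open>Representations built from double stars\<close>

text \<open>Two products meet iff they meet in every factor, so a construction may index its
  dimensions by any finite set and never mention boxes.\<close>

lemma representation_of_interval_family:
  fixes J :: "'i \<Rightarrow> 'a \<Rightarrow> real set"
  assumes T: "finite T" and int: "\<And>i v. i \<in> T \<Longrightarrow> v \<in> V \<Longrightarrow> real_interval (J i v)"
    and card: "\<And>v. v \<in> V \<Longrightarrow> card {i \<in> T. bounded (J i v)} \<le> d"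
    and adj: "\<And>u v. u \<in> V \<Longrightarrow> v \<in> V \<Longrightarrow> u \<noteq> v \<Longrightarrow> {u, v} \<in> E \<longleftrightarrow> (\<forall>i\<in>T. J i u \<inter> J i v \<noteq> {})"
  shows "\<exists>d' B. local_box_representation V E d d' B"
proof -
  obtain f where f: "bij_betw f {1..card T} T"
    using ex_bij_betw_nat_finite_1[OF T] by blast
  then have fT: "f i \<in> T" if "i \<in> {1..card T}" for i using that by (rule bij_betwE[THEN bspec])
  \<comment> \<open>The padding secures \<open>1 \<le> d'\<close> and \<open>d \<le> d'\<close>; the
    added factors \<open>UNIV\<close> are unbounded and separate nothing.\<close>
  define d' where "d' = card T + d + 1"
  define I where "I v i = (if i \<in> {1..card T} then J (f i) v else UNIV)" for v i
  define B where "B v = (\<Pi>\<^sub>E i\<in>{1..d'}. I v i)" for v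
  have "local_box d d' (B v)" if v: "v \<in> V" for v
    unfolding local_box_def
  proof (intro exI[of _ "I v"] conjI ballI)
    show "real_interval (I v i)" for i
      using int[OF fT v] by (auto simp: I_def real_interval_def)
    have "{i \<in> {1..d'}. bounded (I v i)} \<subseteq> {i \<in> {1..card T}. bounded (J (f i) v)}"
      by (auto simp: I_def split: if_splits)
    then have "card {i \<in> {1..d'}. bounded (I v i)} \<le> card {i \<in> {1..card T}. bounded (J (f i) v)}"
      by (intro card_mono) auto
    also have "\<dots> \<le> card {i \<in> T. bounded (J i v)}"
    proof (rule card_inj_on_le[of f])
      show "inj_on f {i \<in> {1..card T}. bounded (J (f i) v)}"
        using f by (rule inj_on_subset[OF bij_betw_imp_inj_on]) blast
    qed (use T fT in auto)
    also have "\<dots> \<le> d" by (rule card[OF v])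
    finally show "card {i \<in> {1..d'}. bounded (I v i)} \<le> d" .
  qed (simp add: B_def)
  moreover have "{u, v} \<in> E \<longleftrightarrow> B u \<inter> B v \<noteq> {}" if uv: "u \<in> V" "v \<in> V" "u \<noteq> v" for u v
  proof -
    have "B u \<inter> B v \<noteq> {} \<longleftrightarrow> (\<forall>i\<in>{1..d'}. I u i \<inter> I v i \<noteq> {})"
      by (simp add: B_def PiE_Int PiE_eq_empty_iff)
    also have "\<dots> \<longleftrightarrow> (\<forall>i\<in>{1..card T}. J (f i) u \<inter> J (f i) v \<noteq> {})"
      by (auto simp: I_def d'_def)
    also have "\<dots> \<longleftrightarrow> (\<forall>i\<in>f ` {1..card T}. J i u \<inter> J i v \<noteq> {})" by simp
    also have "f ` {1..card T} = T" using f by (simp add: bij_betw_def)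
    finally show ?thesis using adj[OF uv] by simp
  qed
  ultimately have "local_box_representation V E d d' B"
    by (simp add: local_box_representation_def d'_def)
  then show ?thesis by blast
qed

lemma doubleton_in_complement_edges:
  "u \<in> V \<Longrightarrow> v \<in> V \<Longrightarrow> u \<noteq> v \<Longrightarrow> {u, v} \<in> complement_edges V E \<longleftrightarrow> {u, v} \<notin> E"
  by (simp add: complement_edges_def)

lemma finite_complement_edges: "finite V \<Longrightarrow> finite (complement_edges V E)"
  by (rule finite_subset[of _ "Pow V"]) (auto simp: complement_edges_def)

text \<open>Every pair \<open>(b, c)\<close> in \<open>T\<close> gives one dimension, representing the double star with centres
  \<open>b\<close> and \<open>c\<close> whose leaves are the heads of the edges leaving \<open>b\<close> and \<open>c\<close> in a balanced orientation
  of the remaining edges; a pair \<open>(b, b)\<close> encodes an ordinary star.\<close>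

lemma double_star_representation:
  fixes V :: "'a set" and E :: "'a set set"
  defines "H \<equiv> complement_edges V E"
  assumes V: "finite V" and girth: "5 \<le> girth H"
    and T: "T \<subseteq> V \<times> V" "\<And>v. v \<in> V \<Longrightarrow> \<exists>!p. p \<in> T \<and> v \<in> {fst p, snd p}"
    and TH: "\<And>b c. (b, c) \<in> T \<Longrightarrow> b = c \<or> {b, c} \<in> H"
    and deg: "\<And>v. v \<in> V \<Longrightarrow> card {e \<in> H - (\<lambda>(b, c). {b, c}) ` T. v \<in> e} \<le> 2 * q"
  shows "\<exists>d' B. local_box_representation V E (q + 1) d' B"
proof -
  define F where "F = H - (\<lambda>(b, c). {b, c}) ` T"
  have finH: "finite H" unfolding H_def by (rule finite_complement_edges[OF V])
  have finT: "finite T" using T(1) V by (auto intro: finite_subset)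
  have H2: "card e = 2" "e \<subseteq> V" if "e \<in> H" for e
    using that by (auto simp: H_def complement_edges_def)
  have FH: "F \<subseteq> H" by (auto simp: F_def)
  obtain h where h: "\<And>e. e \<in> F \<Longrightarrow> h e \<in> e"
      and hdeg: "\<And>v. 2 * card {e \<in> F. h e = v} \<le> card {e \<in> F. v \<in> e} + 1"
    using balanced_orientation[of F] finite_subset[OF FH finH] H2(1) FH by blast
  \<comment> \<open>The out-neighbours of \<open>b\<close> in the orientation: the leaves of the
    star centred at \<open>b\<close>.\<close>
  define A where "A b = {v. {b, v} \<in> F \<and> h {b, v} = v}" for b
  \<comment> \<open>The centre \<open>b\<close> sits at 0 and \<open>c\<close> at 3. Leaves of
    \<open>b\<close> avoid 0 but contain 3, leaves of \<open>c\<close> avoid 3 but contain 0, and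
    all leaves share the segment from 1 to 2. For \<open>b = c\<close> only the point 0 and the
    leaves of \<open>b\<close> remain.\<close>
  define J where "J = (\<lambda>(b, c) v. if v = b then {0} else if v = c then {3}
    else if v \<in> A b then {1..3} else if v \<in> A c then {0..2} else (UNIV :: real set))"
  have AH: "{b, v} \<in> H \<and> b \<noteq> v" if "v \<in> A b" for b v
    using that H2(1)[of "{b, v}"] FH by (auto simp: A_def)
  have Tneq: "{b, c} \<notin> F" if "(b, c) \<in> T" for b c
    using imageI[OF that, of "\<lambda>(b, c). {b, c}"] by (simp add: F_def)
  \<comment> \<open>A common leaf would close a triangle with the central edge. Hence the test for
    \<open>A b\<close> in \<open>J\<close> never hides a leaf of \<open>c\<close>.\<close>
  have disj: False if "(b, c) \<in> T" "b \<noteq> c" "v \<in> A b" "v \<in> A c" for b c v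
  proof -
    have "{b, c} \<in> H" "{b, v} \<in> H" "{c, v} \<in> H" "b \<noteq> v" "c \<noteq> v"
      using TH[OF that(1)] AH[OF that(3)] AH[OF that(4)] that(2) by auto
    then show False using girth_ge_5_no_triangle[OF girth, of b c v] that(2)
      by (simp add: insert_commute)
  qed
  show ?thesis
  proof (rule representation_of_interval_family[OF finT])
    show "real_interval (J p v)" for p v
      by (auto simp: J_def real_interval_def is_interval_1 split: prod.split)
    fix v assume v: "v \<in> V"
    define cl where "cl u = (THE p. p \<in> T \<and> u \<in> {fst p, snd p})" for u
    have cl: "cl u = p" if "p \<in> T" "u \<in> {fst p, snd p}" for u p
    proof -
      have "u \<in> V" using T(1) that by auto
      from the1_equality[OF T(2)[OF this]] show ?thesis unfolding cl_def using that by blast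
    qed
    \<comment> \<open>For an edge with head \<open>v\<close>, this is the pair containing its tail.
      Thus \<open>v\<close> is bounded only in its own pair and in at most as many others as its
      in-degree.\<close>
    define g where "g e = cl (SOME u. u \<in> e \<and> u \<noteq> v)" for e
    have g: "g {u, v} = cl u" if "u \<noteq> v" for u
    proof -
      have "(SOME w. w \<in> {u, v} \<and> w \<noteq> v) = u" using that by (intro some_equality) auto
      then show ?thesis by (simp add: g_def)
    qed
    have leaf: "p \<in> g ` {e \<in> F. h e = v}" if "p \<in> T" "u \<in> {fst p, snd p}" "v \<in> A u" for p u
    proof (rule image_eqI)
      show "p = g {u, v}" using g[of u] cl[OF that(1,2)] AH[OF that(3)] by simp
      show "{u, v} \<in> {e \<in> F. h e = v}" using that(3) by (simp add: A_def)
    qed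
    have "{p \<in> T. bounded (J p v)} \<subseteq> insert (cl v) (g ` {e \<in> F. h e = v})"
    proof
      fix p assume p: "p \<in> {p \<in> T. bounded (J p v)}"
      then consider "v \<in> {fst p, snd p}" | "v \<in> A (fst p)" | "v \<in> A (snd p)"
        by (auto simp: J_def split: if_splits prod.splits)
      then show "p \<in> insert (cl v) (g ` {e \<in> F. h e = v})"
        using p cl[of p v] leaf[of p "fst p"] leaf[of p "snd p"] by cases auto
    qed
    then have "card {p \<in> T. bounded (J p v)} \<le> card (insert (cl v) (g ` {e \<in> F. h e = v}))"
      using finite_subset[OF FH finH] by (intro card_mono) auto
    also have "\<dots> \<le> Suc (card (g ` {e \<in> F. h e = v}))" by (rule card_insert_le_m1) auto
    also have "\<dots> \<le> Suc (card {e \<in> F. h e = v})"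
      using finite_subset[OF FH finH] by (simp add: card_image_le)
    also have "\<dots> \<le> q + 1" using hdeg[of v] deg[OF v] by (simp add: F_def)
    finally show "card {p \<in> T. bounded (J p v)} \<le> q + 1" .
  next
    fix u v assume uv: "u \<in> V" "v \<in> V" "u \<noteq> v"
    \<comment> \<open>An edge leaving \<open>u\<close> is realised in the dimension of the pair
      containing \<open>u\<close>; its head is no centre there, because central edges are not in
      \<open>F\<close>.\<close>
    have star: "\<exists>p\<in>T. J p u \<inter> J p v = {}" if u: "u \<in> V" and v: "v \<in> A u" for u v
    proof -
      obtain p where "p \<in> T" "u \<in> {fst p, snd p}" using T(2)[OF u] by blast
      then obtain b c where p: "(b, c) \<in> T" "u = b \<or> u = c" by (cases p) auto
      have "v \<noteq> u" "{u, v} \<in> F" using AH[OF v] v by (auto simp: A_def)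
      then have "v \<noteq> b" "v \<noteq> c" using p Tneq[OF p(1)] by (auto simp: insert_commute)
      moreover have "v \<notin> A b" if "u \<noteq> b" using disj[OF p(1)] that p(2) v by auto
      ultimately have "J (b, c) u \<inter> J (b, c) v = {}"
        using p(2) v by (auto simp: J_def)
      with p(1) show ?thesis by blast
    qed
    have "{u, v} \<in> H \<longleftrightarrow> (\<exists>p\<in>T. J p u \<inter> J p v = {})"
    proof
      assume uvH: "{u, v} \<in> H"
      show "\<exists>p\<in>T. J p u \<inter> J p v = {}"
      proof (cases "{u, v} \<in> F")
        case True
        then have "v \<in> A u \<or> u \<in> A v"
          using h[OF True] by (auto simp: A_def insert_commute)
        then show ?thesis using star[of u v] star[of v u] uv by (auto simp: Int_commute)
      next
        case False
        with uvH obtain b c where bc: "(b, c) \<in> T" "{u, v} = {b, c}" by (auto simp: F_def)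
        then have "J (b, c) u \<inter> J (b, c) v = {}" using uv(3) by (auto simp: J_def doubleton_eq_iff)
        with bc(1) show ?thesis by blast
      qed
    next
      assume "\<exists>p\<in>T. J p u \<inter> J p v = {}"
      then obtain b c where bc: "(b, c) \<in> T" "J (b, c) u \<inter> J (b, c) v = {}" by auto
      \<comment> \<open>The points 0, 3 and 1 witness intersections: 0 with the centre
        \<open>b\<close>, 3 with the centre \<open>c\<close>, and 1 between any two non-centres. So
        only edges of the double star are separated.\<close>
      have J: "w = b \<or> w \<noteq> c \<and> w \<notin> A b \<Longrightarrow> 0 \<in> J (b, c) w"
          "w \<noteq> b \<Longrightarrow> w = c \<or> w \<notin> A c \<Longrightarrow> 3 \<in> J (b, c) w"
          "w \<noteq> b \<Longrightarrow> w \<noteq> c \<Longrightarrow> 1 \<in> J (b, c) w" for w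
        by (auto simp: J_def)
      have centre: "{w, z} \<in> H" if wz: "w \<in> {b, c}" "w \<noteq> z" "J (b, c) w \<inter> J (b, c) z = {}" for w z
      proof (cases "w = b")
        case True
        then have "0 \<notin> J (b, c) z" using J(1)[of b] wz(3) by blast
        then have "z = c \<or> z \<in> A b" using J(1)[of z] by blast
        then show ?thesis using True TH[OF bc(1)] AH[of z b] wz(2) by blast
      next
        case False
        then have w: "w = c" using wz(1) by blast
        then have "3 \<notin> J (b, c) z" using J(2)[of w] False wz(3) by blast
        then have "z = b \<or> z \<in> A c" using J(2)[of z] by blast
        then show ?thesis using w TH[OF bc(1)] AH[of z c] wz(2) by (auto simp: insert_commute)
      qed
      have "u \<in> {b, c} \<or> v \<in> {b, c}" using J(3)[of u] J(3)[of v] bc(2) by blast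
      then show "{u, v} \<in> H"
        using centre[of u v] centre[of v u] uv(3) bc(2) by (auto simp: insert_commute Int_commute)
    qed
    then show "{u, v} \<in> E \<longleftrightarrow> (\<forall>p\<in>T. J p u \<inter> J p v \<noteq> {})"
      using doubleton_in_complement_edges[OF uv] by (auto simp: H_def)
  qed
qed

section \<open>Dimensions of a representation as double stars\<close>

text \<open>Otherwise \<open>y \<le> x\<close> and \<open>x' \<le> y'\<close> with \<open>x\<close>,
  \<open>x'\<close> in \<open>S\<close> and \<open>y\<close>, \<open>y'\<close> in \<open>T\<close>;
  the larger of \<open>x'\<close> and \<open>y\<close> then lies between two points of the other
  interval.\<close>

lemma disjoint_intervals_ordered:
  fixes S T :: "real set"
  assumes "is_interval S" "is_interval T" "S \<inter> T = {}"
  shows "(\<forall>x\<in>S. \<forall>y\<in>T. x < y) \<or> (\<forall>x\<in>T. \<forall>y\<in>S. x < y)"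
proof (rule ccontr)
  assume "\<not> ?thesis"
  then obtain x y x' y' where xy: "x \<in> S" "y \<in> T" "y \<le> x" "x' \<in> S" "y' \<in> T" "x' \<le> y'"
    by (meson not_less)
  have "y \<in> S" if "x' \<le> y" using assms(1) xy that unfolding is_interval_1 by blast
  moreover have "x' \<in> T" if "y \<le> x'" using assms(2) xy that unfolding is_interval_1 by blast
  ultimately show False using assms(3) xy linear[of x' y] by blast
qed

text \<open>The hypothesis \<open>two_two\<close> makes the sets \<open>{y. R x y}\<close> a chain
  under inclusion, so one of maximum size contains all others.\<close>

lemma interval_order_dominating_element:
  assumes fin: "finite {(x, y). R x y}" and ne: "R x0 y0"
    and two_two: "\<And>a b c d. R a b \<Longrightarrow> R c d \<Longrightarrow> R a d \<or> R c b"
  shows "\<exists>a. \<forall>x y. R x y \<longrightarrow> R a y"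
proof -
  have fN: "finite {y. R x y}" for x
    by (rule finite_subset[OF _ finite_imageI[OF fin, of snd]]) force
  have "finite (card ` (\<lambda>x. {y. R x y}) ` fst ` {(x, y). R x y})" using fin by simp
  then obtain a b where ab: "R a b" and max: "\<And>x y. R x y \<Longrightarrow> card {y. R x y} \<le> card {y. R a y}"
  proof -
    let ?S = "card ` (\<lambda>x. {y. R x y}) ` fst ` {(x, y). R x y}"
    assume *: "finite ?S"
    have "?S \<noteq> {}" using ne by auto
    then have "Max ?S \<in> ?S" using * by (rule Max_in[rotated])
    then obtain a b where "R a b" "Max ?S = card {y. R a y}" by auto
    moreover have "card {y. R x y} \<le> Max ?S" if "R x y" for x y
      using that * by (intro Max_ge) force+
    ultimately show thesis using that by metis
  qed
  have "R a y" if "R x y" for x y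
  proof (rule ccontr)
    assume n: "\<not> R a y"
    then have "insert y {y. R a y} \<subseteq> {y. R x y}"
      using two_two[OF _ \<open>R x y\<close>] \<open>R x y\<close> by auto
    then have "card (insert y {y. R a y}) \<le> card {y. R x y}" by (rule card_mono[OF fN])
    then show False using max[OF that] n fN[of a] by simp
  qed
  then show ?thesis by blast
qed

text \<open>The domination lemma, applied to the order and to its converse, gives \<open>a\<close>
  below every non-minimal and \<open>c\<close> above every non-maximal vertex. An edge avoiding both
  would span a 4-cycle with them.\<close>

lemma co_interval_graph_dominating_edge:
  fixes I :: "'a \<Rightarrow> real set" and V :: "'a set"
  defines "F \<equiv> {{u, v} |u v. u \<in> V \<and> v \<in> V \<and> I u \<inter> I v = {}}"
  assumes V: "finite V" and I: "\<And>v. v \<in> V \<Longrightarrow> is_interval (I v) \<and> I v \<noteq> {}"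
    and FH: "F \<subseteq> H" and girth: "5 \<le> girth H" and ne: "F \<noteq> {}"
  shows "\<exists>m\<in>F. \<forall>e\<in>F. e \<inter> m \<noteq> {}"
proof -
  define R where "R u v \<longleftrightarrow> u \<in> V \<and> v \<in> V \<and> (\<forall>x\<in>I u. \<forall>y\<in>I v. x < y)" for u v
  have RF: "{u, v} \<in> F" if "R u v" for u v
  proof -
    have "I u \<inter> I v = {}" using that by (force simp: R_def)
    then show ?thesis using that by (auto simp: F_def R_def)
  qed
  then have RH: "{u, v} \<in> H" if "R u v" for u v using that FH by blast
  have FR: "\<exists>u v. e = {u, v} \<and> R u v" if "e \<in> F" for e
  proof -
    obtain u v where uv: "e = {u, v}" "u \<in> V" "v \<in> V" "I u \<inter> I v = {}"
      using \<open>e \<in> F\<close> by (auto simp: F_def)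
    then have "R u v \<or> R v u"
      using disjoint_intervals_ordered[of "I u" "I v"] I by (simp add: R_def)
    moreover have "e = {v, u}" using uv(1) by (simp add: insert_commute)
    ultimately show ?thesis using uv(1) by blast
  qed
  have Rirr: "u \<noteq> v" if "R u v" for u v using that I[of u] by (auto simp: R_def)
  have two_two: "R a d \<or> R c b" if "R a b" "R c d" for a b c d
  \<comment> \<open>Failure of both would give \<open>y \<le> x < y' \<le> x' < y\<close>.\<close>
  proof (rule ccontr)
    assume "\<not> ?thesis"
    moreover have "a \<in> V" "b \<in> V" "c \<in> V" "d \<in> V" using that by (simp_all add: R_def)
    ultimately obtain x y x' y' where "x \<in> I a" "y \<in> I d" "y \<le> x" "x' \<in> I c" "y' \<in> I b" "y' \<le> x'"
      unfolding R_def by (meson not_less)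
    then have "x < y'" "x' < y" using that by (auto simp: R_def)
    with \<open>y \<le> x\<close> \<open>y' \<le> x'\<close> show False by linarith
  qed
  obtain x0 y0 where R0: "R x0 y0" using ne FR by blast
  have fin: "finite {(x, y). R x y}"
    by (rule finite_subset[of _ "V \<times> V"]) (auto simp: R_def V)
  obtain a where a: "\<And>x y. R x y \<Longrightarrow> R a y"
    using interval_order_dominating_element[of R, OF fin R0 two_two] by blast
  have "finite {(x, y). R y x}"
    by (rule finite_subset[of _ "V \<times> V"]) (auto simp: R_def V)
  then have "\<exists>c. \<forall>x y. R y x \<longrightarrow> R y c"
  proof (rule interval_order_dominating_element[of "\<lambda>x y. R y x", OF _ R0])
    show "R d a \<or> R b c" if "R b a" "R d c" for a b c d using two_two[OF that] by blast
  qed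
  then obtain c where c: "\<And>x y. R x y \<Longrightarrow> R x c" by blast
  have ac: "R a c" using a c R0 by blast
  moreover have "e \<inter> {a, c} \<noteq> {}" if e: "e \<in> F" for e
  proof (rule ccontr)
    assume n: "\<not> ?thesis"
    obtain x y where xy: "e = {x, y}" "R x y" using FR[OF e] by blast
    have "R a y" "R x c" using a c xy(2) by auto
    then have "{a, c} \<in> H" "{c, x} \<in> H" "{x, y} \<in> H" "{y, a} \<in> H"
      using RH[OF ac] RH[OF xy(2)] RH[of a y] RH[of x c] by (auto simp: insert_commute)
    moreover have "distinct [a, c, x, y]" using n xy(1) Rirr[OF xy(2)] Rirr[OF ac] by auto
    ultimately show False by (rule girth_ge_5_no_4_cycle[OF girth])
  qed
  ultimately show ?thesis using RF[of a c] by blast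
qed

section \<open>Counting in double stars and matchings\<close>

text \<open>An edge at \<open>v\<close> must end in one of the two vertices of \<open>m\<close>;
  having both such edges would make a triangle.\<close>

lemma dominating_edge_degree:
  assumes "5 \<le> girth H" "F \<subseteq> H" "finite F" "\<And>e. e \<in> F \<Longrightarrow> card e = 2"
    "m \<in> F" "\<And>e. e \<in> F \<Longrightarrow> e \<inter> m \<noteq> {}" "v \<notin> m"
  shows "card {e \<in> F. v \<in> e} \<le> 1"
proof -
  obtain a c where m: "m = {a, c}" "a \<noteq> c" using assms(4)[OF assms(5)] by (auto simp: card_2_iff)
  have *: "e = {v, a} \<or> e = {v, c}" if e: "e \<in> F" "v \<in> e" for e
  proof -
    obtain p q where "e = {p, q}" "p \<noteq> q" using assms(4)[OF e(1)] by (auto simp: card_2_iff)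
    then show ?thesis using assms(6)[OF e(1)] assms(7) e(2) m(1) by auto
  qed
  have "\<not> ({v, a} \<in> F \<and> {v, c} \<in> F)"
    using girth_ge_5_no_triangle[OF assms(1), of v a c] assms(2,5,7) m
    by (auto simp: insert_commute)
  then have "e = e'" if "e \<in> {e \<in> F. v \<in> e}" "e' \<in> {e \<in> F. v \<in> e}" for e e'
    using that *[of e] *[of e'] by auto
  then show ?thesis using assms(3) by (auto simp: card_le_Suc0_iff_eq)
qed

text \<open>Every edge except \<open>m\<close> has a vertex outside \<open>m\<close>, and that
  vertex is on no other edge of \<open>F\<close>. Hence \<open>card F - 1\<close> is at most
  \<open>card (\<Union>F) - 2\<close>.\<close>

lemma dominating_edge_card:
  assumes "5 \<le> girth H" "F \<subseteq> H" "finite F" "\<And>e. e \<in> F \<Longrightarrow> card e = 2"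
    "m \<in> F" "\<And>e. e \<in> F \<Longrightarrow> e \<inter> m \<noteq> {}"
  shows "card F + 1 \<le> card (\<Union>F)"
proof -
  define g where "g v = (SOME e. e \<in> F \<and> v \<in> e)" for v
  have finU: "finite (\<Union>F)" using assms(3,4) by (intro finite_Union) (auto intro: card_ge_0_finite)
  have "F - {m} \<subseteq> g ` (\<Union>F - m)"
  proof
    fix e assume e: "e \<in> F - {m}"
    have "\<not> e \<subseteq> m" using e assms(4)[of e] assms(4)[OF assms(5)]
      by (metis Diff_iff card_subset_eq card_ge_0_finite insertI1 zero_less_numeral)
    then obtain v where v: "v \<in> e" "v \<notin> m" by blast
    have "g v \<in> F \<and> v \<in> g v" unfolding g_def by (rule someI[of _ e]) (use e v in auto)
    moreover have "card {e \<in> F. v \<in> e} \<le> Suc 0"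
      using dominating_edge_degree[OF assms v(2)] by simp
    ultimately have "g v = e" using e v(1) assms(3) by (auto simp: card_le_Suc0_iff_eq)
    then show "e \<in> g ` (\<Union>F - m)" using e v by blast
  qed
  then have "card (F - {m}) \<le> card (g ` (\<Union>F - m))" using finU by (intro card_mono) auto
  also have "\<dots> \<le> card (\<Union>F - m)" using finU by (intro card_image_le) auto
  also have "\<dots> = card (\<Union>F) - 2"
  proof -
    have "m \<subseteq> \<Union>F" using assms(5) by blast
    with finU have "card (\<Union>F - m) = card (\<Union>F) - card m"
      by (intro card_Diff_subset) (rule finite_subset)
    then show ?thesis using assms(4)[OF assms(5)] by simp
  qed
  finally have "card F - 1 \<le> card (\<Union>F) - 2" using assms(3,5) by simp
  moreover have "card m \<le> card (\<Union>F)" using assms(5) finU by (intro card_mono) auto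
  moreover have "card F > 0" using assms(3,5) by (auto simp: card_gt_0_iff)
  ultimately show ?thesis using assms(4)[OF assms(5)] by linarith
qed

lemma ex1_if_card_1: "card {e \<in> M. v \<in> e} = 1 \<Longrightarrow> \<exists>!e. e \<in> M \<and> v \<in> e"
  by (erule card_1_singletonE) (auto simp: set_eq_iff)

text \<open>The degrees in \<open>M\<close> are at least 1 and sum to \<open>2 * card M\<close>, so
  none can exceed 1.\<close>

lemma perfect_matching_if_small_edge_cover:
  assumes V: "finite V" and M: "finite M" "M \<subseteq> H" "\<And>e. e \<in> M \<Longrightarrow> e \<subseteq> V \<and> card e = 2"
    and cov: "\<And>v. v \<in> V \<Longrightarrow> \<exists>e\<in>M. v \<in> e" and small: "2 * card M \<le> card V"
  shows "perfect_matching V H M"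
proof -
  have pos: "1 \<le> card {e \<in> M. v \<in> e}" if "v \<in> V" for v
    using cov[OF that] M(1) by (auto simp: Suc_le_eq card_gt_0_iff)
  have "(\<Sum>v\<in>V. card {e \<in> M. v \<in> e}) = 2 * card M"
    using sum_degrees[OF V M(1)] M(3) by simp
  then have "(\<Sum>v\<in>V. card {e \<in> M. v \<in> e} - 1) = 0"
    using small pos by (simp add: sum_subtractf_nat)
  then have zero: "\<forall>v\<in>V. card {e \<in> M. v \<in> e} - 1 = 0"
    by (simp only: sum_eq_0_iff[OF V])
  have "\<exists>!e. e \<in> M \<and> v \<in> e" if "v \<in> V" for v
  proof (rule ex1_if_card_1)
    show "card {e \<in> M. v \<in> e} = 1" using pos[OF that] bspec[OF zero that] by linarith
  qed
  then show ?thesis using M(2) by (simp add: perfect_matching_def)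
qed

section \<open>The lower bound\<close>

lemma representation_lower_bound:
  fixes V :: "'a set" and E :: "'a set set"
  defines "H \<equiv> complement_edges V E"
  assumes V: "finite V" "V \<noteq> {}" and k: "1 \<le> k" and reg: "regular_graph k V H"
    and girth: "5 \<le> girth H" and rep: "local_box_representation V E d d' B"
  shows "k < 2 * d \<and> (2 * d = k + 1 \<longrightarrow> (\<exists>M. perfect_matching V H M))"
proof -
  let ?D = "{1..d'}"
  have "\<forall>v\<in>V. \<exists>I. (\<forall>i\<in>?D. real_interval (I i)) \<and> B v = (\<Pi>\<^sub>E i\<in>?D. I i) \<and>
          card {i \<in> ?D. bounded (I i)} \<le> d"
    using rep by (auto simp: local_box_representation_def local_box_def)
  then obtain I where "\<forall>v\<in>V. (\<forall>i\<in>?D. real_interval (I v i)) \<and> B v = (\<Pi>\<^sub>E i\<in>?D. I v i) \<and>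
          card {i \<in> ?D. bounded (I v i)} \<le> d"
    by (rule bchoice[THEN exE])
  then have I: "\<And>v i. v \<in> V \<Longrightarrow> i \<in> ?D \<Longrightarrow> real_interval (I v i)"
      "\<And>v. v \<in> V \<Longrightarrow> B v = (\<Pi>\<^sub>E i\<in>?D. I v i)"
      "\<And>v. v \<in> V \<Longrightarrow> card {i \<in> ?D. bounded (I v i)} \<le> d"
    by blast+
  define F where "F i = {{u, v} |u v. u \<in> V \<and> v \<in> V \<and> I u i \<inter> I v i = {}}" for i
  have I': "is_interval (I v i) \<and> I v i \<noteq> {}" if "v \<in> V" "i \<in> ?D" for v i
    using I(1)[OF that] by (auto simp: real_interval_def)
  have edge: "{u, v} \<in> H \<longleftrightarrow> (\<exists>i\<in>?D. I u i \<inter> I v i = {})" if uv: "u \<in> V" "v \<in> V" "u \<noteq> v" for u v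
  proof -
    have "{u, v} \<in> E \<longleftrightarrow> B u \<inter> B v \<noteq> {}"
      using rep uv by (auto simp: local_box_representation_def)
    moreover have "B u \<inter> B v = (\<Pi>\<^sub>E i\<in>?D. I u i \<inter> I v i)"
      using I(2) uv by (simp add: PiE_Int)
    ultimately show ?thesis
      using doubleton_in_complement_edges[OF uv] by (simp add: H_def PiE_eq_empty_iff)
  qed
  have H2: "card e = 2" "e \<subseteq> V" if "e \<in> H" for e
    using that by (auto simp: H_def complement_edges_def)
  have finH: "finite H" unfolding H_def by (rule finite_complement_edges[OF V(1)])
  have FH: "F i \<subseteq> H" if i: "i \<in> ?D" for i
  proof
    fix e assume "e \<in> F i"
    then obtain u v where uv: "e = {u, v}" "u \<in> V" "v \<in> V" "I u i \<inter> I v i = {}"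
      by (auto simp: F_def)
    then have "u \<noteq> v" using I'[OF _ i] by auto
    then show "e \<in> H" using edge uv i by blast
  qed
  have HF: "\<exists>i\<in>?D. e \<in> F i" if e: "e \<in> H" for e
  proof -
    obtain u v where uv: "e = {u, v}" "u \<noteq> v" using H2(1)[OF e] by (auto simp: card_2_iff)
    then show ?thesis using edge[of u v] H2(2)[OF e] e by (auto simp: F_def)
  qed
  have finF: "finite (F i)" if "i \<in> ?D" for i using finite_subset[OF FH[OF that] finH] .
  \<comment> \<open>Only dimensions with an edge have a central edge and gain the extra 1 in the
    count.\<close>
  define D where "D = {i \<in> ?D. F i \<noteq> {}}"
  have finD: "finite D" by (simp add: D_def)
  have "\<forall>i\<in>D. \<exists>m\<in>F i. \<forall>e\<in>F i. e \<inter> m \<noteq> {}"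
  proof
    fix i assume i: "i \<in> D"
    then have iD: "i \<in> ?D" "F i \<noteq> {}" by (auto simp: D_def)
    show "\<exists>m\<in>F i. \<forall>e\<in>F i. e \<inter> m \<noteq> {}"
      using co_interval_graph_dominating_edge[of V "\<lambda>v. I v i" H] V(1) I'[OF _ iD(1)]
        FH[OF iD(1)] girth iD(2)
      unfolding F_def by blast
  qed
  then obtain m where m: "\<And>i. i \<in> D \<Longrightarrow> m i \<in> F i" "\<And>i e. i \<in> D \<Longrightarrow> e \<in> F i \<Longrightarrow> e \<inter> m i \<noteq> {}"
    by metis
  \<comment> \<open>The whole line meets every nonempty interval, so a vertex on an edge of
    \<open>F i\<close> is bounded in dimension \<open>i\<close>.\<close>
  have UF: "v \<in> V \<and> bounded (I v i)" if i: "i \<in> ?D" and v: "v \<in> \<Union>(F i)" for i v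
  proof -
    obtain u where u: "u \<in> V" "v \<in> V" "I u i \<inter> I v i = {}" using v by (auto simp: F_def)
    then have "I v i \<noteq> UNIV" using I'[OF u(1) i] by auto
    then show ?thesis using I(1)[OF u(2) i] u(2) by (auto simp: real_interval_def)
  qed
  have star: "card (F i) + 1 \<le> card {v \<in> V. bounded (I v i)}" if i: "i \<in> D" for i
  proof -
    have iD: "i \<in> ?D" using i by (simp add: D_def)
    have "card (F i) + 1 \<le> card (\<Union>(F i))"
      using H2(1) FH[OF iD]
      by (intro dominating_edge_card[OF girth FH[OF iD] finF[OF iD] _ m(1)[OF i] m(2)[OF i]]) auto
    also have "\<dots> \<le> card {v \<in> V. bounded (I v i)}"
      using V(1) UF[OF iD] by (intro card_mono) auto
    finally show ?thesis .
  qed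
  have "H \<subseteq> (\<Union>i\<in>D. F i)" using HF unfolding D_def by blast
  then have "card H \<le> card (\<Union>i\<in>D. F i)"
    using finD finF by (intro card_mono) (auto simp: D_def)
  also have "\<dots> \<le> (\<Sum>i\<in>D. card (F i))" by (rule card_UN_le[OF finD])
  finally have "card H + card D \<le> (\<Sum>i\<in>D. card (F i) + 1)"
    by (simp only: sum.distrib card_eq_sum[symmetric] add_le_mono1)
  also have "\<dots> \<le> (\<Sum>i\<in>D. card {v \<in> V. bounded (I v i)})" by (rule sum_mono) (rule star)
  also have "\<dots> = (\<Sum>v\<in>V. card {i \<in> D. bounded (I v i)})"
    using sum.swap_restrict[OF finD V(1), of "\<lambda>_ _. 1::nat" "\<lambda>i v. bounded (I v i)"] by simp
  also have "\<dots> \<le> (\<Sum>v\<in>V. d)"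
  proof (rule sum_mono)
    fix v assume "v \<in> V"
    moreover have "card {i \<in> D. bounded (I v i)} \<le> card {i \<in> ?D. bounded (I v i)}"
      by (intro card_mono) (auto simp: D_def)
    ultimately show "card {i \<in> D. bounded (I v i)} \<le> d" using I(3) by (meson order_trans)
  qed
  finally have count: "card H + card D \<le> card V * d" by simp
  have deg: "card {e \<in> H. v \<in> e} = k" if "v \<in> V" for v
    using reg that by (simp add: regular_graph_def)
  have handshake: "card V * k = 2 * card H"
    using sum_degrees[OF V(1) finH] H2 deg by simp
  obtain v0 where "v0 \<in> V" using V(2) by blast
  then have "H \<noteq> {}" using deg[of v0] k by auto
  then have "D \<noteq> {}" using HF unfolding D_def by blast
  then have "0 < card D" using finD by (simp add: card_gt_0_iff)
  \<comment> \<open>Strict, because \<open>card D\<close> is positive.\<close>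
  then have "card V * k < card V * (2 * d)" using count handshake by simp
  then have kd: "k < 2 * d" by simp
  moreover have "\<exists>M. perfect_matching V H M" if d: "2 * d = k + 1"
  proof (cases "k = 1")
    case True
    then have "\<exists>!e. e \<in> H \<and> v \<in> e" if "v \<in> V" for v
      using deg[OF that] by (intro ex1_if_card_1) simp
    then have "perfect_matching V H H" by (simp add: perfect_matching_def)
    then show ?thesis by (rule exI)
  next
    case False
    \<comment> \<open>A vertex that is never a centre has at most one edge per dimension, and edges
      only where it is bounded. Then \<open>k \<le> d\<close>, which with
      \<open>2 * d = k + 1\<close> forces \<open>k = 1\<close>.\<close>
    have cov: "\<exists>i\<in>D. v \<in> m i" if v: "v \<in> V" for v
    proof (rule ccontr)
      assume n: "\<not> ?thesis"
      let ?K = "{i \<in> ?D. v \<in> \<Union>(F i)}"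
      have sub: "{e \<in> H. v \<in> e} \<subseteq> (\<Union>i\<in>?K. {e \<in> F i. v \<in> e})"
      proof
        fix e assume e: "e \<in> {e \<in> H. v \<in> e}"
        then obtain i where "i \<in> ?D" "e \<in> F i" using HF[of e] by blast
        with e show "e \<in> (\<Union>i\<in>?K. {e \<in> F i. v \<in> e})" by (intro UN_I[of i]) auto
      qed
      have "card {e \<in> H. v \<in> e} \<le> card (\<Union>i\<in>?K. {e \<in> F i. v \<in> e})"
        by (rule card_mono[OF _ sub]) (simp add: finF)
      then have "k \<le> card (\<Union>i\<in>?K. {e \<in> F i. v \<in> e})" by (simp only: deg[OF v])
      also have "\<dots> \<le> (\<Sum>i\<in>?K. card {e \<in> F i. v \<in> e})" by (rule card_UN_le) simp
      also have "\<dots> \<le> (\<Sum>i\<in>?K. 1)"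
      proof (rule sum_mono)
        fix i assume i: "i \<in> ?K"
        then have iD: "i \<in> ?D" "i \<in> D" by (auto simp: D_def)
        show "card {e \<in> F i. v \<in> e} \<le> 1"
          using H2(1) FH[OF iD(1)] n iD(2)
          by (intro dominating_edge_degree[OF girth FH[OF iD(1)] finF[OF iD(1)] _
                m(1)[OF iD(2)] m(2)[OF iD(2)]]) auto
      qed
      also have "\<dots> = card ?K" by simp
      also have "\<dots> \<le> card {i \<in> ?D. bounded (I v i)}"
        using UF by (intro card_mono) auto
      also have "\<dots> \<le> d" by (rule I(3)[OF v])
      finally show False using d k False by linarith
    qed
    have mH: "m i \<in> H" if "i \<in> D" for i using m(1)[OF that] FH that unfolding D_def by blast
    have "card (m ` D) \<le> card D" by (rule card_image_le[OF finD])
    moreover have "2 * card D \<le> card V"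
    proof -
      \<comment> \<open>As \<open>2 * card H\<close> is \<open>card V * k\<close>, only one
        \<open>card V\<close> is left for \<open>2 * card D\<close>.\<close>
      have "2 * card H + 2 * card D \<le> card V * (2 * d)" using count by simp
      then show ?thesis using handshake by (simp add: d)
    qed
    ultimately have "perfect_matching V H (m ` D)"
      using H2 mH cov by (intro perfect_matching_if_small_edge_cover[OF V(1) finite_imageI[OF finD]]) auto
    then show ?thesis by blast
  qed
  ultimately show ?thesis by blast
qed

section \<open>Upper bounds and the value of the local boxicity\<close>

text \<open>The diagonal pairs make each vertex the centre of its own star.\<close>

lemma representation_by_stars:
  fixes V :: "'a set" and E :: "'a set set"
  defines "H \<equiv> complement_edges V E"
  assumes V: "finite V" and reg: "regular_graph k V H" and girth: "5 \<le> girth H" and k: "k \<le> 2 * q"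
  shows "\<exists>d' B. local_box_representation V E (q + 1) d' B"
proof (rule double_star_representation[OF V, of E "(\<lambda>v. (v, v)) ` V"])
  fix v assume v: "v \<in> V"
  have "card {e \<in> H - X. v \<in> e} \<le> card {e \<in> H. v \<in> e}" for X
    using finite_complement_edges[OF V, of E] by (intro card_mono) (auto simp: H_def)
  also have "\<dots> = k" using reg v by (simp add: regular_graph_def)
  finally show "card {e \<in> complement_edges V E - (\<lambda>(b, c). {b, c}) ` (\<lambda>v. (v, v)) ` V. v \<in> e} \<le> 2 * q"
    using k unfolding H_def by (meson order_trans)
qed (use girth in \<open>auto simp: H_def\<close>)

text \<open>The matching edges serve as central edges. Removing them lowers every degree by one, so
  \<open>k - 1 \<le> 2 * q\<close> suffices.\<close>

lemma representation_by_double_stars: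
  fixes V :: "'a set" and E :: "'a set set"
  defines "H \<equiv> complement_edges V E"
  assumes V: "finite V" and reg: "regular_graph k V H" and girth: "5 \<le> girth H"
    and M: "perfect_matching V H M" and k: "k \<le> 2 * q + 1"
  shows "\<exists>d' B. local_box_representation V E (q + 1) d' B"
proof -
  have H2: "card e = 2" "e \<subseteq> V" if "e \<in> H" for e
    using that by (auto simp: H_def complement_edges_def)
  have MH: "M \<subseteq> H" and ex1: "\<And>v. v \<in> V \<Longrightarrow> \<exists>!e. e \<in> M \<and> v \<in> e"
    using M by (auto simp: perfect_matching_def)
  have "\<exists>p. e = {fst p, snd p}" if "e \<in> M" for e
  proof -
    have "card e = 2" using that MH H2(1) by blast
    then obtain x y where "e = {x, y}" by (auto simp: card_2_iff)
    then show ?thesis by (intro exI[of _ "(x, y)"]) simp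
  qed
  then obtain p where p: "\<And>e. e \<in> M \<Longrightarrow> e = {fst (p e), snd (p e)}" by metis
  have im: "(\<lambda>(b, c). {b, c}) ` p ` M = M"
  proof -
    have "(case p e of (b, c) \<Rightarrow> {b, c}) = e" if "e \<in> M" for e
      unfolding case_prod_beta by (rule p[OF that, symmetric])
    then have "(\<lambda>e. case p e of (b, c) \<Rightarrow> {b, c}) ` M = id ` M" by (intro image_cong) auto
    then show ?thesis by (simp add: image_image)
  qed
  show ?thesis
  proof (rule double_star_representation[OF V, of E "p ` M"])
    show "p ` M \<subseteq> V \<times> V"
    proof
      fix x assume "x \<in> p ` M"
      then obtain e where e: "e \<in> M" "x = p e" by blast
      then have "{fst x, snd x} \<subseteq> V" using p[OF e(1)] H2(2)[of e] MH by auto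
      then show "x \<in> V \<times> V" by (simp add: mem_Times_iff)
    qed
    fix v assume v: "v \<in> V"
    obtain e where e: "e \<in> M" "v \<in> e" "\<And>e'. e' \<in> M \<Longrightarrow> v \<in> e' \<Longrightarrow> e' = e"
      using ex1[OF v] by blast
    show "\<exists>!x. x \<in> p ` M \<and> v \<in> {fst x, snd x}"
    proof (rule ex1I[of _ "p e"])
      show "p e \<in> p ` M \<and> v \<in> {fst (p e), snd (p e)}"
        using e(1,2) by (simp only: p[OF e(1), symmetric]) blast
      show "x = p e" if x: "x \<in> p ` M \<and> v \<in> {fst x, snd x}" for x
      proof -
        obtain e' where e': "e' \<in> M" "x = p e'" using x by blast
        then have "v \<in> e'" using x by (subst p[OF e'(1)]) simp
        then show ?thesis using e(3) e' by blast
      qed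
    qed
    have "{e' \<in> H - M. v \<in> e'} = {e' \<in> H. v \<in> e'} - {e}" using e by blast
    moreover have "card {e' \<in> H. v \<in> e'} = k" using reg v by (simp add: regular_graph_def)
    moreover have "e \<in> {e' \<in> H. v \<in> e'}" using e(1,2) MH by blast
    ultimately have "card {e' \<in> H - M. v \<in> e'} \<le> 2 * q"
      using k finite_complement_edges[OF V, of E] by (simp add: H_def)
    then show "card {e \<in> complement_edges V E - (\<lambda>(b, c). {b, c}) ` p ` M. v \<in> e} \<le> 2 * q"
      by (simp add: im H_def)
  next
    fix b c assume "(b, c) \<in> p ` M"
    then obtain e where e: "e \<in> M" "(b, c) = p e" by blast
    then have "e = {b, c}" using p[OF e(1)] by (metis fst_conv snd_conv)
    then show "b = c \<or> {b, c} \<in> complement_edges V E" using e(1) MH by (auto simp: H_def)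
  qed (use girth in \<open>simp add: H_def\<close>)
qed

lemma lbox_eqI:
  assumes "\<exists>d' B. local_box_representation V E d d' B"
    and "\<And>d1 d' B. local_box_representation V E d1 d' B \<Longrightarrow> d \<le> d1"
  shows "lbox V E = d"
  unfolding lbox_def using assms by (intro Least_equality) auto

lemma lbox_complement_regular:
  fixes V :: "'a set" and E :: "'a set set"
  defines "H \<equiv> complement_edges V E"
  assumes V: "finite V" "V \<noteq> {}" and k: "1 \<le> k" and reg: "regular_graph k V H"
    and girth: "5 \<le> girth H"
  shows "lbox V E =
    (if even k \<or> (\<exists>M. perfect_matching V H M) then k div 2 + 1 else (k + 1) div 2 + 1)"
proof (rule lbox_eqI)
  \<comment> \<open>For odd \<open>k\<close> without a perfect matching,
    \<open>2 * d = k + 1\<close> is excluded, and parity leaves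
    \<open>2 * d \<ge> k + 3\<close>.\<close>
  show "(if even k \<or> (\<exists>M. perfect_matching V H M) then k div 2 + 1 else (k + 1) div 2 + 1) \<le> d"
    if "local_box_representation V E d d' B" for d d' B
    using representation_lower_bound[OF V k reg[unfolded H_def] girth[unfolded H_def] that]
    unfolding H_def by (auto elim!: evenE oddE)
  consider "even k" | M where "perfect_matching V H M"
    | "odd k" "\<not> (\<exists>M. perfect_matching V H M)" by blast
  then show "\<exists>d' B. local_box_representation V E
      (if even k \<or> (\<exists>M. perfect_matching V H M) then k div 2 + 1 else (k + 1) div 2 + 1) d' B"
  proof cases
    case 1
    then have "k \<le> 2 * (k div 2)" by simp
    from representation_by_stars[OF V(1) reg[unfolded H_def] girth[unfolded H_def] this] 1
    show ?thesis by simp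
  next
    case (2 M)
    have "k \<le> 2 * (k div 2) + 1" by simp
    from representation_by_double_stars[OF V(1) reg[unfolded H_def] girth[unfolded H_def]
        2[unfolded H_def] this] 2
    show ?thesis by auto
  next
    case 3
    have "k \<le> 2 * ((k + 1) div 2)" by simp
    from representation_by_stars[OF V(1) reg[unfolded H_def] girth[unfolded H_def] this] 3
    show ?thesis by simp
  qed
qed

theorem theorem1p6:
  fixes V :: "'a set" and E :: "'a set set" and k :: nat
  assumes "simple_graph V E" and "V \<noteq> {}" and "1 \<le> k"
    and "regular_graph k V (complement_edges V E)"
    and "5 \<le> girth (complement_edges V E)"
  shows "(even k \<or> (odd k \<and> (\<exists>M. perfect_matching V (complement_edges V E) M))
            \<longrightarrow> int (lbox V E) = \<lfloor>real k / 2 + 1\<rfloor>) \<and>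
         (odd k \<and> \<not> (\<exists>M. perfect_matching V (complement_edges V E) M)
            \<longrightarrow> real (lbox V E) = (real k + 3) / 2)"
proof -
  have "finite V" using assms(1) by (simp add: simple_graph_def)
  note lbox = lbox_complement_regular[OF this assms(2-5)]
  have "\<lfloor>real k / 2 + 1\<rfloor> = int (k div 2 + 1)"
    using floor_divide_of_nat_eq[of k 2] by simp
  moreover have "real ((k + 1) div 2 + 1) = (real k + 3) / 2" if "odd k"
    using that by (auto elim: oddE)
  ultimately show ?thesis unfolding lbox by auto
qed

end
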